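(* Let $\mathbb{K}\in\{\mathbb{R},\mathbb{C}\}$, let $\mathbf{A},\mathbf{C}\in\mathbb{IK}^{m\times m}$, $\mathbf{B},\mathbf{D}\in\mathbb{IK}^{n\times n}$, $\mathbf{F}\in\mathbb{IK}^{m\times n}$, and consider the interval generalized Sylvester matrix equation $\mathbf{A}X\mathbf{B}+\mathbf{C}X\mathbf{D}=\mathbf{F}$ with united solution set $$\Xi=\{X\in\mathbb{K}^{m\times n}:\ \exists A\in\mathbf{A},\ \exists B\in\mathbf{B},\ \exists C\in\mathbf{C},\ \exists D\in\mathbf{D},\ \exists F\in\mathbf{F},\ AXB+CXD=F\}.$$ Let $U,V,D_A,D_B,D_C,D_D,\mathbf{A}_p,\mathbf{B}_p,\mathbf{C}_p,\mathbf{D}_p,\mathbf{F}_p,S,\Lambda$ and $R=\Lambda^{-1}\in\mathbb{K}^{mn\times mn}$ be as defined in the context, and let $\tilde X\in\mathbb{K}^{m\times n}$ and $\mathbf{X}\in\mathbb{IK}^{m\times n}$ be given, where $X^{\Delta}$ denotes the radius matrix of $\mathbf{X}$. Define $$\mathbf{M}=\big(\mathbf{F}_{p}-(\mathbf{A}_{p}\tilde X)\mathbf{B}_{p}-(\mathbf{C}_{p}\tilde X)\mathbf{D}_{p}\big)./S,$$ $$\mathbf{N}=\Big\langle 0,\ \big(A_{p}^{\Delta}X^{\Delta}|B_{p}^{c}|+\operatorname{mag}(\mathbf{A}_{p})X^{\Delta}B_{p}^{\Delta}+C_{p}^{\Delta}X^{\Delta}|D_{p}^{c}|+\operatorname{mag}(\mathbf{C}_{p})X^{\Delta}D_{p}^{\Delta}\big)./|S|\Big\rangle,$$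 $$\mathbf{H}=\mathbf{M}+\mathbf{N}.$$ If $\mathbf{H}\subseteq\operatorname{int}(\mathbf{X})$, then $R$ is nonsingular and, for every $A\in\mathbf{A}$, $B\in\mathbf{B}$, $C\in\mathbf{C}$, $D\in\mathbf{D}$, $F\in\mathbf{F}$, the corresponding generalized Sylvester matrix equation $AXB+CXD=F$ has a unique solution $\hat X$, and $\hat X\in U(\tilde X+\mathbf{X})V^{-1}$. Therefore $\Xi\subseteq U(\tilde X+\mathbf{X})V^{-1}$. Here $U(\tilde X+\mathbf{X})V^{-1}$ denotes the set $\{U(\tilde X+X)V^{-1}: X\in\mathbf{X}\}$.
   Context: Intervals. An interval over $\mathbb{K}$ is a set $\langle x^{c},x^{\Delta}\rangle=\{x\in\mathbb{K}:|x-x^{c}|\le x^{\Delta}\}$ with midpoint $x^{c}\in\mathbb{K}$ and radius $0\le x^{\Delta}\in\mathbb{R}$. $\mathbb{IK}^{p\times q}$ is the set of $p\times q$ matrices $\mathbf{M}$ of such intervals; $M\in\mathbf{M}$ and inclusions between interval matrices are entrywise; $M^{c},M^{\Delta}$ are the matrices of midpoints and radii; $\langle M^c,M^\Delta\rangle$ is the interval matrix with these midpoints and radii; $\operatorname{mag}(\mathbf{M})=|M^{c}|+M^{\Delta}$, where $|\cdot|$ is the entrywise absolute value. $\operatorname{int}(\mathbf{X})$ is the entrywise topological interior in $\mathbb{K}$. Point matrices are identified with interval matrices of zero radius. Interval arithmetic. Operations $\circ\in\{+,-,\cdot,/\}$ on intervals are those of a fixed interval arithmetic with the enclosure property $\{x\circ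 y:x\in\mathbf{x},y\in\mathbf{y}\}\subseteq\mathbf{x}\circ\mathbf{y}$, for instance midpoint-radius arithmetic, where $\langle a,r\rangle\pm\langle b,s\rangle=\langle a\pm b,r+s\rangle$, $\langle a,r\rangle\langle b,s\rangle=\langle ab,|a|s+r|b|+rs\rangle$, and $\langle a,r\rangle/t=\langle a/t,r/|t|\rangle$ for $0\ne t\in\mathbb{K}$. Products of interval matrices are computed entrywise by the usual formula with these operations. $./$ denotes entrywise (Hadamard) division. Setting. There are invertible $U\in\mathbb{K}^{m\times m}$, $V\in\mathbb{K}^{n\times n}$ and diagonal matrices $D_A,D_C\in\mathbb{K}^{m\times m}$, $D_B,D_D\in\mathbb{K}^{n\times n}$ with $$A^{c}=UD_AU^{-1},\quad C^{c}=UD_CU^{-1},\quad B^{c}=VD_BV^{-1},\quad D^{c}=VD_DV^{-1}.$$ Put $\mathbf{A}_p=U^{-1}\mathbf{A}U$, $\mathbf{B}_p=V^{-1}\mathbf{B}V$, $\mathbf{C}_p=U^{-1}\mathbf{C}U$, $\mathbf{D}_p=V^{-1}\mathbf{D}V$, $\mathbf{F}_p=U^{-1}\mathbf{F}V$ (interval evaluations). Their midpoints are assumed to satisfy $A_p^{c}=D_A$, $B_p^{c}=D_B$, $C_p^{c}=D_C$, $D_p^{c}=D_D$. Let $\Lambda=D_B\otimes D_A+D_D\otimes D_C$ ($\otimes$ the Kronecker product), a diagonal $mn\times mn$ matrix, and let $S\in\mathbb{K}^{m\times n}$ be the matrix with $\Lambda=\operatorname{Diag}(\operatorname{vec}(S))$,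 where $\operatorname{vec}$ stacks columns; that is, $S_{ij}=(D_B)_{jj}(D_A)_{ii}+(D_D)_{jj}(D_C)_{ii}$. Put $R=\Lambda^{-1}$ (so $\Lambda$ is taken to be invertible).
   Formalization: The two enclosure claims (X̂ ∈ U(X̃+X)V⁻¹ and Ξ ⊆ U(X̃+X)V⁻¹) are proved only when X has midpoint 0, since they fail otherwise (A=⟨1,1/2⟩, B=F=1, C=D=0, X̃=0, X=⟨1,1/10⟩); nonsingularity of R and unique solvability are proved for every X. *)

theory Defs
  imports "HOL-Analysis.Analysis"
begin

text \<open>
  The scalar field is a type \<open>'k\<close> of class \<open>real_normed_field\<close>, which has \<open>real\<close> and
  \<open>complex\<close> as instances; the absolute value is \<open>norm\<close>.  A \<open>p \<times> q\<close> matrix has type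
  \<open>'k^'q^'p\<close>, also written \<open>('k, 'p, 'q) matrix\<close>.  The index types are finite and linearly ordered, like \<open>{1..p}\<close>: interval
  addition need not be associative, so the order of summation in a product of interval
  matrices has to be fixed.
\<close>

type_synonym ('k, 'p, 'q) matrix = "(('k, 'q) vec, 'p) vec"

subsection \<open>Intervals and interval arithmetic\<close>

text \<open>
  An interval is encoded by its midpoint and radius, which are uniquely determined by the set
  \<open>ival_set\<close>.
\<close>

typedef (overloaded) ('k::real_normed_field) ival = "{p :: 'k \<times> real. 0 \<le> snd p}"
  by (rule exI[of _ "(0, 0)"]) simp

setup_lifting type_definition_ival

lift_definition mid :: "'k::real_normed_field ival \<Rightarrow> 'k" is fst .

lift_definition rad :: "'k::real_normed_field ival \<Rightarrow> real" is snd .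

text \<open>The truncation only makes the function total; it is applied to radii \<open>r \<ge> 0\<close>.\<close>

lift_definition ival :: "'k::real_normed_field \<Rightarrow> real \<Rightarrow> 'k ival" is "\<lambda>c r. (c, max 0 r)"
  by simp

definition ival_set :: "'k::real_normed_field ival \<Rightarrow> 'k set" where
  "ival_set x = {z. norm (z - mid x) \<le> rad x}"

record 'k iarith =
  iadd :: "'k ival \<Rightarrow> 'k ival \<Rightarrow> 'k ival"
  isub :: "'k ival \<Rightarrow> 'k ival \<Rightarrow> 'k ival"
  imul :: "'k ival \<Rightarrow> 'k ival \<Rightarrow> 'k ival"
  idiv :: "'k ival \<Rightarrow> 'k ival \<Rightarrow> 'k ival"

definition interval_arithmetic :: "'k::real_normed_field iarith \<Rightarrow> bool" where
  "interval_arithmetic ar \<longleftrightarrow>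
     (\<forall>x y. {a + b |a b. a \<in> ival_set x \<and> b \<in> ival_set y} \<subseteq> ival_set (iadd ar x y)) \<and>
     (\<forall>x y. {a - b |a b. a \<in> ival_set x \<and> b \<in> ival_set y} \<subseteq> ival_set (isub ar x y)) \<and>
     (\<forall>x y. {a * b |a b. a \<in> ival_set x \<and> b \<in> ival_set y} \<subseteq> ival_set (imul ar x y)) \<and>
     (\<forall>x y. 0 \<notin> ival_set y \<longrightarrow>
        {a / b |a b. a \<in> ival_set x \<and> b \<in> ival_set y} \<subseteq> ival_set (idiv ar x y))"

text \<open>
  Midpoint-radius arithmetic is an example.  For a divisor of radius \<open>0\<close> the quotient is
  \<open>\<langle>a/t, r/|t|\<rangle>\<close>; the formula extends this to all divisors \<open>\<langle>b, s\<rangle>\<close> with \<open>s < |b|\<close>.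
\<close>

definition midrad_arithmetic :: "'k::real_normed_field iarith" where
  "midrad_arithmetic =
     \<lparr>iadd = \<lambda>x y. ival (mid x + mid y) (rad x + rad y),
      isub = \<lambda>x y. ival (mid x - mid y) (rad x + rad y),
      imul = \<lambda>x y. ival (mid x * mid y)
               (norm (mid x) * rad y + rad x * norm (mid y) + rad x * rad y),
      idiv = \<lambda>x y. ival (mid x / mid y)
               ((rad x + norm (mid x) * rad y / norm (mid y)) / (norm (mid y) - rad y))\<rparr>"

lemma rad_nonneg [simp]: "0 \<le> rad x"
  by transfer simp

lemma mid_ival [simp]: "mid (ival c r) = c"
  by transfer simp

lemma rad_ival [simp]: "0 \<le> r \<Longrightarrow> rad (ival c r) = r"
  by transfer simp

lemma interval_arithmetic_midrad:
  "interval_arithmetic (midrad_arithmetic :: 'k::real_normed_field iarith)"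
proof -
  have add: "a + b \<in> ival_set (iadd midrad_arithmetic x y)"
    and sub: "a - b \<in> ival_set (isub midrad_arithmetic x y)"
    and mul: "a * b \<in> ival_set (imul midrad_arithmetic x y)"
    and quot: "0 \<notin> ival_set y \<Longrightarrow> a / b \<in> ival_set (idiv midrad_arithmetic x y)"
    if "a \<in> ival_set x" "b \<in> ival_set y" for a b :: 'k and x y
  proof -
    have a: "norm (a - mid x) \<le> rad x" and b: "norm (b - mid y) \<le> rad y"
      using that by (auto simp: ival_set_def)
    show "a + b \<in> ival_set (iadd midrad_arithmetic x y)"
      using norm_triangle_ineq[of "a - mid x" "b - mid y"] a b
      by (simp add: ival_set_def midrad_arithmetic_def algebra_simps)
    show "a - b \<in> ival_set (isub midrad_arithmetic x y)"
      using norm_triangle_ineq4[of "a - mid x" "b - mid y"] a b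
      by (simp add: ival_set_def midrad_arithmetic_def algebra_simps)
    have "norm (a * b - mid x * mid y)
        = norm (mid x * (b - mid y) + (a - mid x) * mid y + (a - mid x) * (b - mid y))"
      by (simp add: algebra_simps)
    also have "\<dots> \<le> norm (mid x) * norm (b - mid y) + norm (a - mid x) * norm (mid y)
        + norm (a - mid x) * norm (b - mid y)"
      by (intro norm_triangle_le add_mono) (simp_all add: norm_mult)
    also have "\<dots> \<le> norm (mid x) * rad y + rad x * norm (mid y) + rad x * rad y"
      using a b by (intro add_mono mult_mono) auto
    finally show "a * b \<in> ival_set (imul midrad_arithmetic x y)"
      by (simp add: ival_set_def midrad_arithmetic_def)
    assume "0 \<notin> ival_set y"
    then have y: "rad y < norm (mid y)"
      by (simp add: ival_set_def not_le)
    have y0: "mid y \<noteq> 0" and ypos: "0 < norm (mid y)"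
      using y le_less_trans[OF rad_nonneg y] by auto
    have "norm (mid y) \<le> norm b + norm (b - mid y)"
      by (metis norm_minus_commute norm_triangle_sub)
    then have b_low: "norm (mid y) - rad y \<le> norm b"
      using b by linarith
    then have b0: "b \<noteq> 0" and bpos: "0 < norm b"
      using y by auto
    have "a / b - mid x / mid y = ((a - mid x) * mid y - mid x * (b - mid y)) / (b * mid y)"
      using b0 y0 by (simp add: field_simps)
    then have "norm (a / b - mid x / mid y)
        = norm ((a - mid x) * mid y - mid x * (b - mid y)) / (norm b * norm (mid y))"
      by (simp add: norm_divide norm_mult)
    also have "\<dots> \<le> (rad x * norm (mid y) + norm (mid x) * rad y)
        / ((norm (mid y) - rad y) * norm (mid y))"
    proof (rule frac_le)
      have "norm ((a - mid x) * mid y - mid x * (b - mid y))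
          \<le> norm (a - mid x) * norm (mid y) + norm (mid x) * norm (b - mid y)"
        by (metis norm_mult norm_triangle_ineq4)
      also have "\<dots> \<le> rad x * norm (mid y) + norm (mid x) * rad y"
        using a b by (intro add_mono mult_mono) auto
      finally show "norm ((a - mid x) * mid y - mid x * (b - mid y))
          \<le> rad x * norm (mid y) + norm (mid x) * rad y" .
    qed (use y ypos b_low in \<open>auto intro!: mult_right_mono\<close>)
    also have "\<dots> = (rad x + norm (mid x) * rad y / norm (mid y)) / (norm (mid y) - rad y)"
      using ypos y by (simp add: field_simps)
    finally show "a / b \<in> ival_set (idiv midrad_arithmetic x y)"
      using y by (simp add: ival_set_def midrad_arithmetic_def)
  qed
  show ?thesis
    unfolding interval_arithmetic_def
  proof (intro conjI allI impI subsetI; elim CollectE exE conjE)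
  qed (simp_all only: add sub mul quot not_False_eq_True)
qed

subsection \<open>Interval matrices\<close>

definition midm :: "('k::real_normed_field ival)^'q^'p \<Rightarrow> 'k^'q^'p" where
  "midm M = (\<chi> i j. mid (M $ i $ j))"

definition radm :: "('k::real_normed_field ival)^'q^'p \<Rightarrow> real^'q^'p" where
  "radm M = (\<chi> i j. rad (M $ i $ j))"

definition imat :: "'k::real_normed_field^'q^'p \<Rightarrow> real^'q^'p \<Rightarrow> ('k ival)^'q^'p" where
  "imat C R = (\<chi> i j. ival (C $ i $ j) (R $ i $ j))"

definition point :: "'k::real_normed_field^'q^'p \<Rightarrow> ('k ival)^'q^'p" where
  "point P = imat P 0"

definition imat_set :: "('k::real_normed_field ival)^'q^'p \<Rightarrow> ('k^'q^'p) set" where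
  "imat_set M = {P. \<forall>i j. P $ i $ j \<in> ival_set (M $ i $ j)}"

definition subset_int ::
  "('k::real_normed_field ival)^'q^'p \<Rightarrow> ('k ival)^'q^'p \<Rightarrow> bool" where
  "subset_int H X \<longleftrightarrow> (\<forall>i j. ival_set (H $ i $ j) \<subseteq> interior (ival_set (X $ i $ j)))"

definition mabs :: "'k::real_normed_field^'q^'p \<Rightarrow> real^'q^'p" where
  "mabs P = (\<chi> i j. norm (P $ i $ j))"

definition mag :: "('k::real_normed_field ival)^'q^'p \<Rightarrow> real^'q^'p" where
  "mag M = mabs (midm M) + radm M"

definition hdiv :: "'k::field^'q^'p \<Rightarrow> 'k^'q^'p \<Rightarrow> 'k^'q^'p" where
  "hdiv P Q = (\<chi> i j. P $ i $ j / Q $ i $ j)"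

definition imat_add ::
  "'k::real_normed_field iarith \<Rightarrow> ('k ival)^'q^'p \<Rightarrow> ('k ival)^'q^'p \<Rightarrow> ('k ival)^'q^'p" where
  "imat_add ar M N = (\<chi> i j. iadd ar (M $ i $ j) (N $ i $ j))"

definition imat_sub ::
  "'k::real_normed_field iarith \<Rightarrow> ('k ival)^'q^'p \<Rightarrow> ('k ival)^'q^'p \<Rightarrow> ('k ival)^'q^'p" where
  "imat_sub ar M N = (\<chi> i j. isub ar (M $ i $ j) (N $ i $ j))"

definition imat_hdiv ::
  "'k::real_normed_field iarith \<Rightarrow> ('k ival)^'q^'p \<Rightarrow> ('k ival)^'q^'p \<Rightarrow> ('k ival)^'q^'p" where
  "imat_hdiv ar M N = (\<chi> i j. idiv ar (M $ i $ j) (N $ i $ j))"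

text \<open>Sums are evaluated from left to right, without an initial zero interval.\<close>

definition isum ::
  "'k::real_normed_field iarith \<Rightarrow> ('r::{finite,linorder} \<Rightarrow> 'k ival) \<Rightarrow> 'k ival" where
  "isum ar f = (let ks = sorted_list_of_set UNIV
                in foldl (iadd ar) (f (hd ks)) (map f (tl ks)))"

definition imat_mul ::
  "'k::real_normed_field iarith \<Rightarrow> ('k ival, 'p::finite, 'r::{finite,linorder}) matrix
     \<Rightarrow> ('k ival, 'r, 'q::finite) matrix \<Rightarrow> ('k ival, 'p, 'q) matrix" where
  "imat_mul ar M N = (\<chi> i j. isum ar (\<lambda>k. imul ar (M $ i $ k) (N $ k $ j)))"

subsection \<open>Diagonal matrices, Kronecker product, vectorization\<close>

definition diagonal_matrix :: "'k::zero^'p^'p \<Rightarrow> bool" where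
  "diagonal_matrix P \<longleftrightarrow> (\<forall>i j. i \<noteq> j \<longrightarrow> P $ i $ j = 0)"

definition Diag :: "'k::zero^'p \<Rightarrow> 'k^'p^'p" where
  "Diag v = (\<chi> i j. if i = j then v $ i else 0)"

text \<open>
  A column-stacked \<open>m \<times> n\<close> matrix is indexed by pairs (column, row), to be thought of as
  ordered lexicographically.  This is also the index type of \<open>Q \<otimes> P\<close> with \<open>Q\<close> of size
  \<open>n \<times> n\<close> and \<open>P\<close> of size \<open>m \<times> m\<close>.
\<close>

definition vec_cols :: "'k^'n^'m \<Rightarrow> 'k^('n \<times> 'm)" where
  "vec_cols X = (\<chi> p. X $ snd p $ fst p)"

definition kronecker ::
  "'k::times^'n^'n \<Rightarrow> 'k^'m^'m \<Rightarrow> 'k^('n \<times> 'm)^('n \<times> 'm)" where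
  "kronecker Q P = (\<chi> p q. Q $ fst p $ fst q * P $ snd p $ snd q)"

subsection \<open>The united solution set\<close>

definition united_solution_set ::
  "('k::real_normed_field ival)^'m^'m \<Rightarrow> ('k ival)^'n^'n \<Rightarrow> ('k ival)^'m^'m
     \<Rightarrow> ('k ival)^'n^'n \<Rightarrow> ('k ival)^'n^'m \<Rightarrow> ('k^'n^'m) set" where
  "united_solution_set A B C D F =
     {X. \<exists>A0\<in>imat_set A. \<exists>B0\<in>imat_set B. \<exists>C0\<in>imat_set C. \<exists>D0\<in>imat_set D. \<exists>F0\<in>imat_set F.
           A0 ** X ** B0 + C0 ** X ** D0 = F0}"

text \<open>
  A pitfall concerning an enclosure test \<open>\<^bold>M + \<^bold>N \<subseteq> int \<^bold>X\<close> in which \<open>\<^bold>N\<close> depends on \<open>\<^bold>X\<close> only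
  through its radius \<open>X\<^sup>\<Delta>\<close>: such an \<open>\<^bold>N\<close> encloses the Krawczyk remainder on \<open>\<^bold>X\<close> only if \<open>\<^bold>X\<close> has
  midpoint \<open>0\<close>, i.e. \<open>\<^bold>X = \<langle>0, X\<^sup>\<Delta>\<rangle>\<close>.  Unique solvability follows for every midpoint, but the
  enclosure does not: for the scalar equation \<open>aX = 1\<close> with \<open>a \<in> \<langle>1, 1/2\<rangle>\<close>, approximate
  solution \<open>0\<close> and \<open>\<^bold>X = \<langle>1, 1/10\<rangle>\<close> one gets \<open>\<^bold>M + \<^bold>N = \<langle>1, 1/20\<rangle> \<subseteq> int \<^bold>X\<close>, yet \<open>a = 1/2\<close> has the
  solution \<open>2\<close>, which is not in \<open>\<^bold>X\<close>.  Enclosure statements are therefore made for midpoint \<open>0\<close>.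
\<close>

end

theory Submission
  imports Defs
begin

text \<open>
  In the coordinates \<open>W = U\<^sup>-\<^sup>1YV\<close> the equation \<open>AYB + CYD = F\<close> has coefficients in the interval
  matrices \<open>\<^bold>A\<^sub>p, \<^bold>B\<^sub>p, \<^bold>C\<^sub>p, \<^bold>D\<^sub>p\<close>, whose midpoints are diagonal.  The midpoint operator
  multiplies \<open>W\<close> entrywise by \<open>S\<close>, and the actual operator differs from it by a deviation that
  the radii control.  Dividing by \<open>S\<close>, every solution \<open>W\<close> of the transformed equation with
  right-hand side \<open>G\<close> satisfies \<open>|W| \<le> |G ./ S| + T|W|\<close>, where \<open>T\<close> is linear
  and monotone on nonnegative matrices and \<open>T X\<^sup>\<Delta>\<close> is the radius matrix of \<open>\<^bold>N\<close> (\<open>mabs_solution_le_residual_bound\<close>).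

  The inclusion \<open>\<^bold>M + \<^bold>N \<subseteq> int \<^bold>X\<close> implies \<open>|P - X\<^sup>c| + T X\<^sup>\<Delta> < X\<^sup>\<Delta>\<close> entrywise for all
  \<open>P \<in> \<^bold>M\<close> (\<open>norm_add_rad_less_if_subset_int\<close>).  In particular \<open>T X\<^sup>\<Delta> < X\<^sup>\<Delta>\<close>: the operator \<open>T\<close> is a
  contraction in the maximum norm weighted by \<open>X\<^sup>\<Delta>\<close>, so that nonnegative solutions of
  \<open>w \<le> g + T w\<close> lie below \<open>X\<^sup>\<Delta>\<close> as soon as \<open>g + T X\<^sup>\<Delta> < X\<^sup>\<Delta>\<close>
  (\<open>le_supersolution_if_subsolution\<close>).

  This comparison is used twice.  With \<open>g = 0\<close> it bounds the whole kernel of the transformed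
  operator by \<open>X\<^sup>\<Delta>\<close>; a bounded subspace is trivial, and an injective linear operator on a
  finite-dimensional space is bijective, which gives existence and uniqueness.  If \<open>X\<^sup>c = 0\<close>, it
  applies with \<open>g = |G ./ S|\<close> to the correction \<open>W - X\<^sub>t\<close>, where \<open>G\<close> is the residual of the
  approximate solution \<open>X\<^sub>t\<close>: then \<open>G ./ S \<in> \<^bold>M\<close>, and the correction lies in \<open>\<^bold>X\<close>.
\<close>

section \<open>Entrywise order and absolute values of matrices\<close>

lemma matrix_le_iff: "(P :: real^'q^'p) \<le> Q \<longleftrightarrow> (\<forall>i j. P $ i $ j \<le> Q $ i $ j)"
  by (simp add: less_eq_vec_def)

lemma matrix_mult_nonneg:
  fixes P :: "real^'r^'p" and Q :: "real^'q^'r"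
  assumes "0 \<le> P" "0 \<le> Q"
  shows "0 \<le> P ** Q"
  using assms by (auto simp: matrix_le_iff matrix_matrix_mult_def intro!: sum_nonneg)

lemma matrix_mult_mono:
  fixes P P' :: "real^'r^'p" and Q Q' :: "real^'q^'r"
  assumes "P \<le> P'" "Q \<le> Q'" "0 \<le> P'" "0 \<le> Q"
  shows "P ** Q \<le> P' ** Q'"
  using assms by (auto simp: matrix_le_iff matrix_matrix_mult_def intro!: sum_mono mult_mono)

lemma two_sided_product_mono:
  fixes P P' :: "real^'m^'p" and W W' :: "real^'n^'m" and Q Q' :: "real^'q^'n"
  assumes "P \<le> P'" "W \<le> W'" "Q \<le> Q'" "0 \<le> P'" "0 \<le> W" "0 \<le> Q"
  shows "P ** W ** Q \<le> P' ** W' ** Q'"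
proof (rule matrix_mult_mono)
  show "P ** W \<le> P' ** W'"
    by (rule matrix_mult_mono) (fact assms)+
  show "0 \<le> P' ** W'"
    by (rule matrix_mult_nonneg[OF assms(4) order_trans[OF assms(5,2)]])
qed (fact assms)+

lemma matrix_add_mono:
  fixes P P' Q Q' :: "real^'q^'p"
  assumes "P \<le> P'" "Q \<le> Q'"
  shows "P + Q \<le> P' + Q'"
  using assms by (auto simp: matrix_le_iff intro: add_mono)

lemma mabs_nonneg: "0 \<le> mabs P"
  by (simp add: matrix_le_iff mabs_def)

lemma radm_nonneg: "0 \<le> radm P"
  by (simp add: matrix_le_iff radm_def)

lemma mag_nonneg: "0 \<le> mag P"
  by (simp add: matrix_le_iff mag_def mabs_def radm_def)

lemma mabs_add_le: "mabs (P + Q) \<le> mabs P + mabs Q"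
  by (simp add: matrix_le_iff mabs_def norm_triangle_ineq)

lemma mabs_mult_le:
  fixes P :: "'k::real_normed_field^'r^'p" and Q :: "'k^'q^'r"
  shows "mabs (P ** Q) \<le> mabs P ** mabs Q"
  by (auto simp: matrix_le_iff mabs_def matrix_matrix_mult_def norm_mult intro!: sum_norm_le)

lemma mabs_two_sided_product_le:
  fixes P :: "'k::real_normed_field^'m^'p" and W :: "'k^'n^'m" and Q :: "'k^'q^'n"
  assumes "mabs P \<le> P'" "mabs Q \<le> Q'"
  shows "mabs (P ** W ** Q) \<le> P' ** mabs W ** Q'"
proof -
  have "mabs (P ** W ** Q) \<le> mabs (P ** W) ** mabs Q"
    by (rule mabs_mult_le)
  also have "\<dots> \<le> (mabs P ** mabs W) ** mabs Q"
    by (rule matrix_mult_mono[OF mabs_mult_le order_refl matrix_mult_nonneg])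
      (rule mabs_nonneg)+
  also have "\<dots> \<le> P' ** mabs W ** Q'"
    by (intro two_sided_product_mono assms order_refl mabs_nonneg
        order_trans[OF mabs_nonneg assms(1)])
  finally show ?thesis .
qed

lemma matrix_add_rdistrib:
  fixes P :: "'k::semiring_1^'r^'p"
  shows "(P + P') ** Q = P ** Q + P' ** Q"
  by (simp add: vec_eq_iff matrix_matrix_mult_def distrib_right sum.distrib)

lemma matrix_diff_ldistrib:
  fixes P :: "'k::ring_1^'r^'p"
  shows "P ** (Q - Q') = P ** Q - P ** Q'"
  by (simp add: vec_eq_iff matrix_matrix_mult_def right_diff_distrib sum_subtractf)

lemma matrix_diff_rdistrib:
  fixes P :: "'k::ring_1^'r^'p"
  shows "(P - P') ** Q = P ** Q - P' ** Q"
  by (simp add: vec_eq_iff matrix_matrix_mult_def left_diff_distrib sum_subtractf)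

section \<open>Enclosure properties of interval matrix operations\<close>

lemma mem_imat_set_iff: "P \<in> imat_set M \<longleftrightarrow> mabs (P - midm M) \<le> radm M"
  by (simp add: imat_set_def ival_set_def matrix_le_iff mabs_def midm_def radm_def)

lemma mabs_le_mag:
  assumes "P \<in> imat_set M"
  shows "mabs P \<le> mag M"
  unfolding mag_def
proof (rule order_trans)
  show "mabs P \<le> mabs (midm M) + mabs (P - midm M)"
    using mabs_add_le[of "midm M" "P - midm M"] by simp
  show "mabs (midm M) + mabs (P - midm M) \<le> mabs (midm M) + radm M"
    using assms by (intro matrix_add_mono) (simp_all add: mem_imat_set_iff)
qed

lemma ival_set_point: "ival_set (point P $ i $ j) = {P $ i $ j}"
  by (simp add: point_def imat_def ival_set_def)

lemma mem_point: "P \<in> imat_set (point P)"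
  by (simp add: imat_set_def ival_set_point)

lemma imat_set_nonempty: "midm M \<in> imat_set M"
  by (simp add: mem_imat_set_iff matrix_le_iff mabs_def radm_def)

lemma interval_arithmeticD:
  assumes "interval_arithmetic ar" "a \<in> ival_set x" "b \<in> ival_set y"
  shows "a + b \<in> ival_set (iadd ar x y)"
    and "a - b \<in> ival_set (isub ar x y)"
    and "a * b \<in> ival_set (imul ar x y)"
    and "0 \<notin> ival_set y \<Longrightarrow> a / b \<in> ival_set (idiv ar x y)"
proof -
  note ops = assms(1)[unfolded interval_arithmetic_def]
  show "a + b \<in> ival_set (iadd ar x y)"
    by (rule subsetD[OF ops[THEN conjunct1, rule_format]]) (use assms(2,3) in blast)
  show "a - b \<in> ival_set (isub ar x y)"
    by (rule subsetD[OF ops[THEN conjunct2, THEN conjunct1, rule_format]])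
      (use assms(2,3) in blast)
  show "a * b \<in> ival_set (imul ar x y)"
    by (rule subsetD[OF ops[THEN conjunct2, THEN conjunct2, THEN conjunct1, rule_format]])
      (use assms(2,3) in blast)
  show "a / b \<in> ival_set (idiv ar x y)" if "0 \<notin> ival_set y"
    by (rule subsetD[OF ops[THEN conjunct2, THEN conjunct2, THEN conjunct2, rule_format, OF that]])
      (use assms(2,3) in blast)
qed

lemma sum_in_isum:
  fixes f :: "'r::{finite,linorder} \<Rightarrow> 'k::real_normed_field ival"
  assumes ar: "interval_arithmetic ar" and g: "\<And>k. g k \<in> ival_set (f k)"
  shows "sum g UNIV \<in> ival_set (isum ar f)"
proof -
  have fold: "a + sum_list (map g ks) \<in> ival_set (foldl (iadd ar) x (map f ks))"
    if "a \<in> ival_set x" for a x ks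
    using that
  proof (induction ks arbitrary: a x)
    case (Cons k ks)
    have "a + g k \<in> ival_set (iadd ar x (f k))"
      by (intro interval_arithmeticD ar g Cons.prems)
    from Cons.IH[OF this] show ?case
      by (simp add: add.assoc)
  qed simp
  define ks where "ks = sorted_list_of_set (UNIV :: 'r set)"
  have ks: "set ks = UNIV" "distinct ks"
    by (simp_all add: ks_def)
  then have "ks \<noteq> []"
    by auto
  then have "sum_list (map g ks) = g (hd ks) + sum_list (map g (tl ks))"
    by (cases ks) simp_all
  moreover have "sum g UNIV = sum_list (map g ks)"
    using ks by (metis sum.distinct_set_conv_list)
  ultimately have "sum g UNIV \<in> ival_set (foldl (iadd ar) (f (hd ks)) (map f (tl ks)))"
    using fold[OF g, of "hd ks" "tl ks"] by (simp only:)
  then show ?thesis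
    by (simp only: isum_def Let_def ks_def)
qed

lemma mult_in_imat_mul:
  assumes ar: "interval_arithmetic ar" and "P \<in> imat_set M" "Q \<in> imat_set N"
  shows "P ** Q \<in> imat_set (imat_mul ar M N)"
  using assms
  by (simp add: imat_set_def imat_mul_def matrix_matrix_mult_def sum_in_isum interval_arithmeticD)

lemma add_in_imat_add:
  assumes "interval_arithmetic ar" "P \<in> imat_set M" "Q \<in> imat_set N"
  shows "P + Q \<in> imat_set (imat_add ar M N)"
  using assms by (simp add: imat_set_def imat_add_def interval_arithmeticD)

lemma diff_in_imat_sub:
  assumes "interval_arithmetic ar" "P \<in> imat_set M" "Q \<in> imat_set N"
  shows "P - Q \<in> imat_set (imat_sub ar M N)"
  using assms by (simp add: imat_set_def imat_sub_def interval_arithmeticD)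

lemma hdiv_in_imat_hdiv:
  assumes "interval_arithmetic ar" "P \<in> imat_set M" "Q \<in> imat_set N"
    and "\<And>i j. 0 \<notin> ival_set (N $ i $ j)"
  shows "hdiv P Q \<in> imat_set (imat_hdiv ar M N)"
  using assms by (simp add: imat_set_def imat_hdiv_def hdiv_def interval_arithmeticD)

text \<open>Moving from a point of \<open>\<^bold>M\<close> by the full radius of \<open>\<^bold>N\<close>, in the direction pointing away from
  the midpoint of \<open>\<^bold>X\<close>, stays inside \<open>\<^bold>M + \<^bold>N\<close>, hence in the open ball around that midpoint.\<close>

lemma norm_add_rad_less_if_subset_int:
  fixes M N X :: "('k::real_normed_field ival)^'q^'p"
  assumes ar: "interval_arithmetic ar" and incl: "subset_int (imat_add ar M N) X"
    and P: "P \<in> imat_set M" and N: "midm N = 0"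
  shows "norm (P $ i $ j - midm X $ i $ j) + radm N $ i $ j < radm X $ i $ j"
proof -
  define z where "z = P $ i $ j - midm X $ i $ j"
  \<comment> \<open>If \<open>z = 0\<close>, every direction points away from the midpoint.\<close>
  define n where "n = (if z = 0 then of_real (radm N $ i $ j)
    else (radm N $ i $ j / norm z) *\<^sub>R z)"
  have rN: "0 \<le> radm N $ i $ j"
    by (simp add: radm_def)
  have n: "norm n = radm N $ i $ j"
    using rN by (simp add: n_def)
  have zn: "norm (z + n) = norm z + radm N $ i $ j"
  proof (cases "z = 0")
    case False
    then have "z + n = (1 + radm N $ i $ j / norm z) *\<^sub>R z"
      by (simp add: n_def scaleR_add_left)
    then have "norm (z + n) = (1 + radm N $ i $ j / norm z) * norm z"
      using rN by simp
    also have "\<dots> = norm z + radm N $ i $ j"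
      using False by (simp add: distrib_right)
    finally show ?thesis .
  qed (use rN in \<open>simp add: n_def\<close>)
  have "mid (N $ i $ j) = 0"
    using N by (simp add: vec_eq_iff midm_def)
  with n have "n \<in> ival_set (N $ i $ j)"
    by (simp add: ival_set_def radm_def)
  moreover have "P $ i $ j \<in> ival_set (M $ i $ j)"
    using P by (simp add: imat_set_def)
  ultimately have "P $ i $ j + n \<in> ival_set (imat_add ar M N $ i $ j)"
    using ar by (simp add: imat_add_def interval_arithmeticD)
  then have "P $ i $ j + n \<in> interior (ival_set (X $ i $ j))"
    using incl unfolding subset_int_def by blast
  moreover have "ival_set (X $ i $ j) = cball (midm X $ i $ j) (radm X $ i $ j)"
    by (simp add: set_eq_iff ival_set_def midm_def radm_def dist_norm norm_minus_commute)
  ultimately have "P $ i $ j + n \<in> ball (midm X $ i $ j) (radm X $ i $ j)"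
    by (simp only: interior_cball)
  then have "norm (z + n) < radm X $ i $ j"
    by (simp add: z_def dist_norm norm_minus_commute[of "midm X $ i $ j"] diff_add_eq)
  with zn show ?thesis
    by (simp add: z_def)
qed

section \<open>Perturbation of a two-sided matrix product\<close>

definition product_deviation ::
  "('k::real_normed_field ival)^'m^'m \<Rightarrow> ('k ival)^'n^'n \<Rightarrow> real^'n^'m \<Rightarrow> real^'n^'m" where
  "product_deviation A B W = radm A ** W ** mabs (midm B) + mag A ** W ** radm B"

lemma product_deviation_mono:
  assumes "0 \<le> W" "W \<le> W'"
  shows "product_deviation A B W \<le> product_deviation A B W'"
  unfolding product_deviation_def
  by (intro matrix_add_mono two_sided_product_mono assms)
    (rule order_refl radm_nonneg mag_nonneg mabs_nonneg)+

lemma product_deviation_scaleR: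
  "product_deviation A B (t *\<^sub>R W) = t *\<^sub>R product_deviation A B W"
  by (simp add: product_deviation_def matrix_scalar_ac scalar_matrix_assoc[symmetric]
      scaleR_add_right)

text \<open>The two terms of the bound come from the splitting
  \<open>PWQ - P\<^sup>cWQ\<^sup>c = (P - P\<^sup>c)WQ\<^sup>c + PW(Q - Q\<^sup>c)\<close>.\<close>

lemma mabs_product_deviation:
  assumes P: "P \<in> imat_set A" and Q: "Q \<in> imat_set B"
  shows "mabs (P ** W ** Q - midm A ** W ** midm B) \<le> product_deviation A B (mabs W)"
proof -
  have "P ** W ** Q - midm A ** W ** midm B
      = (P - midm A) ** W ** midm B + P ** W ** (Q - midm B)"
    by (simp add: matrix_diff_ldistrib matrix_diff_rdistrib)
  also have "mabs \<dots> \<le> mabs ((P - midm A) ** W ** midm B) + mabs (P ** W ** (Q - midm B))"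
    by (rule mabs_add_le)
  also have "\<dots> \<le> product_deviation A B (mabs W)"
    unfolding product_deviation_def
  proof (intro matrix_add_mono mabs_two_sided_product_le)
    show "mabs (P - midm A) \<le> radm A" "mabs (Q - midm B) \<le> radm B"
      using P Q by (simp_all add: mem_imat_set_iff)
  qed (rule order_refl mabs_le_mag[OF P])+
  finally show ?thesis .
qed

section \<open>A bound on the deviation and its contraction property\<close>

text \<open>In midpoint-radius form, \<open>\<^bold>N\<close> is \<open>\<langle>0, T X\<^sup>\<Delta>\<rangle>\<close> for this operator \<open>T\<close>.\<close>

definition residual_bound ::
  "('k::real_normed_field ival)^'m^'m \<Rightarrow> ('k ival)^'n^'n \<Rightarrow> ('k ival)^'m^'m \<Rightarrow> ('k ival)^'n^'n
     \<Rightarrow> 'k^'n^'m \<Rightarrow> real^'n^'m \<Rightarrow> real^'n^'m" where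
  "residual_bound A B C D S W =
     hdiv (product_deviation A B W + product_deviation C D W) (mabs S)"

lemma residual_bound_mono:
  assumes "0 \<le> W" "W \<le> W'"
  shows "residual_bound A B C D S W \<le> residual_bound A B C D S W'"
proof -
  have "product_deviation A B W + product_deviation C D W
      \<le> product_deviation A B W' + product_deviation C D W'"
    using assms by (intro matrix_add_mono product_deviation_mono)
  then show ?thesis
    by (auto simp: residual_bound_def hdiv_def matrix_le_iff mabs_def intro!: divide_right_mono)
qed

lemma residual_bound_scaleR:
  "residual_bound A B C D S (t *\<^sub>R W) = t *\<^sub>R residual_bound A B C D S W"
  by (simp add: residual_bound_def product_deviation_scaleR vec_eq_iff hdiv_def
      distrib_left add_divide_distrib)

lemma residual_bound_nonneg:
  assumes "0 \<le> W"
  shows "0 \<le> residual_bound A B C D S W"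
proof -
  have "residual_bound A B C D S 0 = 0"
    using residual_bound_scaleR[of A B C D S 0 0] by simp
  then show ?thesis
    using residual_bound_mono[OF order_refl assms, of A B C D S] by simp
qed

lemma diagonal_two_sided_product:
  fixes P :: "'k::comm_ring_1^'m^'m" and Q :: "'k^'n^'n"
  assumes "diagonal_matrix P" "diagonal_matrix Q"
  shows "(P ** W ** Q) $ i $ j = P $ i $ i * W $ i $ j * Q $ j $ j"
proof -
  have "(P ** W) $ i $ k = P $ i $ i * W $ i $ k" for k
  proof -
    have "(\<Sum>l\<in>UNIV. P $ i $ l * W $ l $ k)
        = (\<Sum>l\<in>UNIV. if l = i then P $ i $ i * W $ i $ k else 0)"
      using assms(1) by (intro sum.cong) (auto simp: diagonal_matrix_def)
    then show ?thesis
      by (simp add: matrix_matrix_mult_def)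
  qed
  then have "(\<Sum>k\<in>UNIV. (P ** W) $ i $ k * Q $ k $ j)
      = (\<Sum>k\<in>UNIV. if k = j then P $ i $ i * W $ i $ j * Q $ j $ j else 0)"
    using assms(2) by (intro sum.cong) (auto simp: diagonal_matrix_def)
  then show ?thesis
    by (simp add: matrix_matrix_mult_def[of "P ** W"])
qed

text \<open>For diagonal midpoints the operator \<open>W \<mapsto> A\<^sup>cWB\<^sup>c + C\<^sup>cWD\<^sup>c\<close> multiplies \<open>W\<close> entrywise by \<open>S\<close>.
  Hence \<open>W\<close> equals \<open>(G - E) ./ S\<close>, where \<open>E\<close> is the deviation of the two products from their
  midpoint versions; \<open>E\<close> depends on \<open>W\<close>, so that \<open>|W|\<close> appears on both sides.\<close>

lemma mabs_solution_le_residual_bound: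
  assumes diag: "diagonal_matrix (midm A)" "diagonal_matrix (midm B)"
      "diagonal_matrix (midm C)" "diagonal_matrix (midm D)"
    and S: "\<And>i j. S $ i $ j = midm B $ j $ j * midm A $ i $ i + midm D $ j $ j * midm C $ i $ i"
    and S0: "\<And>i j. S $ i $ j \<noteq> 0"
    and mem: "A0 \<in> imat_set A" "B0 \<in> imat_set B" "C0 \<in> imat_set C" "D0 \<in> imat_set D"
    and eq: "A0 ** W ** B0 + C0 ** W ** D0 = G"
  shows "mabs W \<le> mabs (hdiv G S) + residual_bound A B C D S (mabs W)"
proof -
  define E where "E = (A0 ** W ** B0 - midm A ** W ** midm B)
    + (C0 ** W ** D0 - midm C ** W ** midm D)"
  define b where "b = product_deviation A B (mabs W) + product_deviation C D (mabs W)"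
  have "mabs E \<le> b"
    unfolding E_def b_def
    by (rule order_trans[OF mabs_add_le])
      (intro matrix_add_mono mabs_product_deviation mem)
  then have E: "norm (E $ i $ j) \<le> b $ i $ j" for i j
    by (simp add: matrix_le_iff mabs_def)
  have "midm A ** W ** midm B + midm C ** W ** midm D = G - E"
    by (simp add: E_def flip: eq)
  then have "S $ i $ j * W $ i $ j = G $ i $ j - E $ i $ j" for i j
    by (simp add: vec_eq_iff diagonal_two_sided_product diag S algebra_simps)
  then have W: "W $ i $ j = G $ i $ j / S $ i $ j - E $ i $ j / S $ i $ j" for i j
    using S0[of i j] by (simp add: field_simps)
  have "norm (W $ i $ j) \<le> norm (G $ i $ j / S $ i $ j) + b $ i $ j / norm (S $ i $ j)" for i j
  proof -
    have "norm (W $ i $ j) \<le> norm (G $ i $ j / S $ i $ j) + norm (E $ i $ j / S $ i $ j)"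
      unfolding W by (rule norm_triangle_ineq4)
    moreover have "norm (E $ i $ j / S $ i $ j) \<le> b $ i $ j / norm (S $ i $ j)"
      using E[of i j] by (simp add: norm_divide divide_right_mono)
    ultimately show ?thesis by linarith
  qed
  then show ?thesis
    by (simp add: matrix_le_iff mabs_def hdiv_def residual_bound_def b_def)
qed

text \<open>If \<open>t > 1\<close> were the largest ratio of an entry of \<open>w\<close> to that of \<open>r\<close>, attained at some
  position, then \<open>w \<le> t r\<close> would bound the entry there by \<open>g + t T r \<le> t (g + T r) < t r\<close>,
  which is that entry.\<close>

lemma le_supersolution_if_subsolution:
  fixes w g r :: "real^'n^'m"
  assumes mono: "\<And>x y. 0 \<le> x \<Longrightarrow> x \<le> y \<Longrightarrow> T x \<le> T y"
    and scale: "\<And>t x. T (t *\<^sub>R x) = t *\<^sub>R T x"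
    and w: "0 \<le> w" "w \<le> g + T w" and g: "0 \<le> g"
    and r: "\<And>i j. 0 < r $ i $ j" "\<And>i j. g $ i $ j + T r $ i $ j < r $ i $ j"
  shows "w \<le> r"
proof -
  define \<rho> where "\<rho> = (\<lambda>p. w $ fst p $ snd p / r $ fst p $ snd p)"
  define t where "t = Max (range \<rho>)"
  have "t \<in> range \<rho>"
    unfolding t_def by (rule Max_in) auto
  then obtain i j where ij: "t = w $ i $ j / r $ i $ j"
    by (auto simp: \<rho>_def)
  have wt: "w \<le> t *\<^sub>R r"
  proof -
    have "w $ k $ l / r $ k $ l \<le> t" for k l
      unfolding t_def by (rule Max_ge) (auto simp: \<rho>_def intro!: image_eqI[of _ _ "(k, l)"])
    then show ?thesis
      using r(1) by (simp add: matrix_le_iff pos_divide_le_eq)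
  qed
  have "t \<le> 1"
  proof (rule ccontr)
    assume "\<not> t \<le> 1"
    then have t: "1 < t" by simp
    have "w \<le> g + t *\<^sub>R T r"
      using w(2) mono[OF w(1) wt] order_trans[OF _ matrix_add_mono[OF order_refl]]
      by (simp add: scale)
    then have "w $ i $ j \<le> g $ i $ j + t * T r $ i $ j"
      by (simp add: matrix_le_iff)
    also have "\<dots> \<le> t * (g $ i $ j + T r $ i $ j)"
      using t g mult_right_mono[of 1 t "g $ i $ j"] by (simp add: matrix_le_iff algebra_simps)
    also have "\<dots> < t * r $ i $ j"
      using t r(2)[of i j] by (simp add: mult_strict_left_mono)
    also have "\<dots> = w $ i $ j"
      using ij r(1)[of i j] by simp
    finally show False by simp
  qed
  then have "t *\<^sub>R r \<le> r"
    using r(1) by (simp add: matrix_le_iff)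
  with wt show ?thesis by (rule order_trans)
qed

text \<open>The multiples of a kernel element of a linear operator are again in the kernel; thus a bound
  that holds on the whole kernel makes the kernel trivial.\<close>

lemma zero_if_multiples_bounded:
  fixes W :: "'k::real_normed_field^'n^'m"
  assumes "\<And>t::real. mabs (t *\<^sub>R W) \<le> r"
  shows "W = 0"
proof -
  have bound: "norm (t *\<^sub>R W $ i $ j) \<le> r $ i $ j" for t i j
    using assms[of t] by (simp add: matrix_le_iff mabs_def)
  have "norm (W $ i $ j) = 0" for i j
  proof (rule ccontr)
    assume nz: "norm (W $ i $ j) \<noteq> 0"
    have "norm (((\<bar>r $ i $ j\<bar> + 1) / norm (W $ i $ j)) *\<^sub>R W $ i $ j) \<le> r $ i $ j"
      by (rule bound)
    with nz show False by simp
  qed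
  then show ?thesis by (simp add: vec_eq_iff)
qed

section \<open>Solvability of the generalized Sylvester equation\<close>

lemma inj_vec_cols: "inj vec_cols"
  by (rule injI) (simp add: vec_cols_def vec_eq_iff)

lemma vec_cols_surj: "vec_cols (\<chi> i j. v $ (j, i)) = v"
  by (simp add: vec_cols_def vec_eq_iff)

text \<open>The operator is an endomorphism of a finite-dimensional vector space over the scalar field, so
  that uniqueness implies existence.\<close>

lemma sylvester_unique_solution:
  fixes A C :: "'k::field^'m^'m" and B D :: "'k^'n^'n"
  assumes kernel: "\<And>Z. A ** Z ** B + C ** Z ** D = 0 \<Longrightarrow> Z = 0"
  shows "\<exists>!Y. A ** Y ** B + C ** Y ** D = F"
proof -
  define L where "L = (\<lambda>Y. A ** Y ** B + C ** Y ** D)"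
  define unvec where "unvec = (\<lambda>v :: 'k^('n \<times> 'm). \<chi> i j. v $ (j, i))"
  define f where "f = (\<lambda>v. vec_cols (L (unvec v)))"
  have diff: "L Y - L Z = L (Y - Z)" for Y Z
    by (simp add: L_def matrix_diff_ldistrib matrix_diff_rdistrib)
  have inj: "inj L"
    using kernel diff by (intro injI) (metis L_def right_minus_eq)
  have "Vector_Spaces.linear (*s) (*s) f"
    by unfold_locales
      (simp_all add: f_def L_def unvec_def vec_eq_iff vec_cols_def matrix_matrix_mult_def
        sum.distrib sum_distrib_left sum_distrib_right algebra_simps)
  moreover have "inj unvec"
    by (rule inj_on_inverseI[of _ vec_cols]) (simp add: unvec_def vec_cols_surj)
  then have "inj f"
    unfolding f_def by (intro injI) (metis inj inj_vec_cols injD)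
  ultimately have "surj f"
    by (rule vec.linear_inj_imp_surj)
  then obtain v where "vec_cols F = f v"
    by (metis surjD)
  then have "L (unvec v) = F"
    unfolding f_def by (metis inj_vec_cols injD)
  then have "\<exists>!Y. L Y = F"
    by (metis inj injD)
  then show ?thesis
    by (simp add: L_def)
qed

lemma matrix_inv_inverse:
  assumes "invertible P"
  shows "P ** matrix_inv P = mat 1" "matrix_inv P ** P = mat 1"
proof -
  have "P ** matrix_inv P = mat 1 \<and> matrix_inv P ** P = mat 1"
    unfolding matrix_inv_def using assms unfolding invertible_def by (rule someI_ex)
  then show "P ** matrix_inv P = mat 1" "matrix_inv P ** P = mat 1"
    by simp_all
qed

lemma sylvester_change_of_basis:
  fixes U :: "'k::comm_ring_1^'m^'m" and V :: "'k^'n^'n"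
  assumes "invertible U" "invertible V"
  shows "(matrix_inv U ** P ** U) ** (matrix_inv U ** Z ** V) ** (matrix_inv V ** Q ** V)
    = matrix_inv U ** (P ** Z ** Q) ** V"
proof -
  have "(matrix_inv U ** P ** U) ** (matrix_inv U ** Z ** V) ** (matrix_inv V ** Q ** V)
    = matrix_inv U ** P ** (U ** matrix_inv U) ** Z ** (V ** matrix_inv V) ** Q ** V"
    by (simp only: matrix_mul_assoc)
  then show ?thesis
    by (simp add: matrix_inv_inverse assms matrix_mul_assoc)
qed

lemma Diag_entry_nonzero_if_invertible:
  fixes v :: "'k::field^'p"
  assumes "invertible (Diag v)"
  shows "v $ i \<noteq> 0"
proof
  assume vi: "v $ i = 0"
  have "(Diag v ** matrix_inv (Diag v)) $ i $ i = 0"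
    unfolding matrix_matrix_mult_def using vi by (auto simp: Diag_def intro!: sum.neutral)
  then show False
    by (simp add: matrix_inv_inverse assms mat_def)
qed

section \<open>Enclosure of the united solution set\<close>

theorem theorem2p4:
  fixes ar :: "'k::real_normed_field iarith"
    and A C Ap Cp :: "('k ival, 'm::{finite,linorder}, 'm) matrix"
    and B D Bp Dp :: "('k ival, 'n::{finite,linorder}, 'n) matrix"
    and F Fp M N H X :: "('k ival, 'm, 'n) matrix"
    and U DA DC :: "('k, 'm, 'm) matrix"
    and V DB DD :: "('k, 'n, 'n) matrix"
    and S Xt :: "('k, 'm, 'n) matrix"
    and \<Lambda> R :: "('k, 'n \<times> 'm, 'n \<times> 'm) matrix"
  assumes arith: "interval_arithmetic ar"
    and inv: "invertible U" "invertible V"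
    and diag: "diagonal_matrix DA" "diagonal_matrix DB" "diagonal_matrix DC" "diagonal_matrix DD"
    and mids: "midm A = U ** DA ** matrix_inv U" "midm C = U ** DC ** matrix_inv U"
      "midm B = V ** DB ** matrix_inv V" "midm D = V ** DD ** matrix_inv V"
    and Ap: "Ap = imat_mul ar (imat_mul ar (point (matrix_inv U)) A) (point U)"
    and Bp: "Bp = imat_mul ar (imat_mul ar (point (matrix_inv V)) B) (point V)"
    and Cp: "Cp = imat_mul ar (imat_mul ar (point (matrix_inv U)) C) (point U)"
    and Dp: "Dp = imat_mul ar (imat_mul ar (point (matrix_inv V)) D) (point V)"
    and Fp: "Fp = imat_mul ar (imat_mul ar (point (matrix_inv U)) F) (point V)"
    and mids_p: "midm Ap = DA" "midm Bp = DB" "midm Cp = DC" "midm Dp = DD"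
    and \<Lambda>: "\<Lambda> = kronecker DB DA + kronecker DD DC"
    and S: "\<Lambda> = Diag (vec_cols S)"
    and \<Lambda>_inv: "invertible \<Lambda>"
    and R: "R = matrix_inv \<Lambda>"
    and M: "M = imat_hdiv ar
                  (imat_sub ar
                    (imat_sub ar Fp (imat_mul ar (imat_mul ar Ap (point Xt)) Bp))
                    (imat_mul ar (imat_mul ar Cp (point Xt)) Dp))
                  (point S)"
    and N: "N = imat 0
                  (hdiv
                    (radm Ap ** radm X ** mabs (midm Bp) + mag Ap ** radm X ** radm Bp
                      + radm Cp ** radm X ** mabs (midm Dp) + mag Cp ** radm X ** radm Dp)
                    (mabs S))"
    and H: "H = imat_add ar M N"
    and incl: "subset_int H X"
  shows "invertible R \<and>
    (\<forall>A0\<in>imat_set A. \<forall>B0\<in>imat_set B. \<forall>C0\<in>imat_set C. \<forall>D0\<in>imat_set D. \<forall>F0\<in>imat_set F.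
       \<exists>Y. A0 ** Y ** B0 + C0 ** Y ** D0 = F0 \<and>
           (\<forall>Z. A0 ** Z ** B0 + C0 ** Z ** D0 = F0 \<longrightarrow> Z = Y) \<and>
           (midm X = 0 \<longrightarrow> Y \<in> {U ** (Xt + X0) ** matrix_inv V |X0. X0 \<in> imat_set X})) \<and>
    (midm X = 0 \<longrightarrow>
       united_solution_set A B C D F \<subseteq> {U ** (Xt + X0) ** matrix_inv V |X0. X0 \<in> imat_set X})"
proof -
  define T where "T = residual_bound Ap Bp Cp Dp S"
  note inv_simps = matrix_inv_inverse[OF inv(1)] matrix_inv_inverse[OF inv(2)]
  have "invertible R"
    using matrix_inv_inverse[OF \<Lambda>_inv] unfolding R invertible_def by blast
  have S_entry: "S $ i $ j = midm Bp $ j $ j * midm Ap $ i $ i + midm Dp $ j $ j * midm Cp $ i $ i"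
    for i j
  proof -
    have "\<Lambda> $ (j, i) $ (j, i) = S $ i $ j"
      by (simp add: S Diag_def vec_cols_def)
    then show ?thesis
      by (simp add: \<Lambda> kronecker_def mids_p)
  qed
  have S0: "S $ i $ j \<noteq> 0" for i j
    using Diag_entry_nonzero_if_invertible[OF \<Lambda>_inv[unfolded S], of "(j, i)"]
    by (simp add: vec_cols_def)
  have N': "N = imat 0 (T (radm X))"
    by (simp add: N T_def residual_bound_def product_deviation_def add.assoc)
  have T0: "0 \<le> T (radm X)"
    unfolding T_def by (intro residual_bound_nonneg radm_nonneg)
  then have rN: "radm N = T (radm X)" and mN: "midm N = 0"
    by (simp_all add: N' radm_def midm_def imat_def vec_eq_iff matrix_le_iff)
  have strict: "norm (P $ i $ j - midm X $ i $ j) + T (radm X) $ i $ j < radm X $ i $ j"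
    if "P \<in> imat_set M" for P i j
    using norm_add_rad_less_if_subset_int[OF arith incl[unfolded H] that mN] by (simp add: rN)
  \<comment> \<open>The value at one point of \<open>\<^bold>M\<close>, here its midpoint, already shows the contraction.\<close>
  have contr: "T (radm X) $ i $ j < radm X $ i $ j" for i j
    using strict[OF imat_set_nonempty, of i j] norm_ge_zero by (smt (verit))
  have pos: "0 < radm X $ i $ j" for i j
    using contr[of i j] T0 by (simp add: matrix_le_iff) (meson order.strict_trans1)
  have T_mono: "0 \<le> x \<Longrightarrow> x \<le> y \<Longrightarrow> T x \<le> T y" for x y
    unfolding T_def by (rule residual_bound_mono)
  have T_scale: "T (t *\<^sub>R x) = t *\<^sub>R T x" for t x
    unfolding T_def by (rule residual_bound_scaleR)
  have solution: "\<exists>!Y. A0 ** Y ** B0 + C0 ** Y ** D0 = F0"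
      "\<And>Y. midm X = 0 \<Longrightarrow> A0 ** Y ** B0 + C0 ** Y ** D0 = F0 \<Longrightarrow>
        Y \<in> {U ** (Xt + X0) ** matrix_inv V |X0. X0 \<in> imat_set X}"
    if mem: "A0 \<in> imat_set A" "B0 \<in> imat_set B" "C0 \<in> imat_set C" "D0 \<in> imat_set D"
      "F0 \<in> imat_set F" for A0 B0 C0 D0 F0
  proof -
    define A1 where "A1 = matrix_inv U ** A0 ** U"
    define B1 where "B1 = matrix_inv V ** B0 ** V"
    define C1 where "C1 = matrix_inv U ** C0 ** U"
    define D1 where "D1 = matrix_inv V ** D0 ** V"
    define F1 where "F1 = matrix_inv U ** F0 ** V"
    have mem1: "A1 \<in> imat_set Ap" "B1 \<in> imat_set Bp" "C1 \<in> imat_set Cp" "D1 \<in> imat_set Dp"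
      "F1 \<in> imat_set Fp"
      unfolding A1_def B1_def C1_def D1_def F1_def Ap Bp Cp Dp Fp
      by (intro mult_in_imat_mul arith mem_point mem)+
    have transform: "A1 ** (matrix_inv U ** Z ** V) ** B1 + C1 ** (matrix_inv U ** Z ** V) ** D1
        = matrix_inv U ** (A0 ** Z ** B0 + C0 ** Z ** D0) ** V" for Z
      unfolding A1_def B1_def C1_def D1_def
      by (simp add: sylvester_change_of_basis[OF inv] matrix_add_ldistrib matrix_add_rdistrib)
    have untransform: "U ** (matrix_inv U ** Z ** V) ** matrix_inv V = Z" for Z
    proof -
      have "U ** (matrix_inv U ** Z ** V) ** matrix_inv V
          = (U ** matrix_inv U) ** Z ** (V ** matrix_inv V)"
        by (simp only: matrix_mul_assoc)
      then show ?thesis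
        by (simp add: inv_simps)
    qed
    have bound: "mabs W \<le> mabs (hdiv G S) + T (mabs W)"
      if "A1 ** W ** B1 + C1 ** W ** D1 = G" for W G
      unfolding T_def
      using mids_p diag S_entry S0 mem1 that
      by (intro mabs_solution_le_residual_bound) auto
    have kernel: "Z = 0" if Z: "A0 ** Z ** B0 + C0 ** Z ** D0 = 0" for Z
    proof -
      define W where "W = matrix_inv U ** Z ** V"
      have W: "A1 ** W ** B1 + C1 ** W ** D1 = 0"
        using transform[of Z] by (simp add: W_def Z)
      have "mabs (t *\<^sub>R W) \<le> radm X" for t :: real
      proof (rule le_supersolution_if_subsolution[OF T_mono T_scale])
        have "A1 ** (t *\<^sub>R W) ** B1 + C1 ** (t *\<^sub>R W) ** D1
            = t *\<^sub>R (A1 ** W ** B1 + C1 ** W ** D1)"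
          by (simp add: matrix_scalar_ac scalar_matrix_assoc[symmetric]
              scaleR_add_right)
        also have "\<dots> = 0"
          by (simp add: W)
        finally have "mabs (t *\<^sub>R W) \<le> mabs (hdiv 0 S) + T (mabs (t *\<^sub>R W))"
          by (rule bound)
        moreover have "mabs (hdiv 0 S) = 0"
          by (simp add: mabs_def hdiv_def vec_eq_iff)
        ultimately show "mabs (t *\<^sub>R W) \<le> 0 + T (mabs (t *\<^sub>R W))"
          by simp
      qed (simp_all add: mabs_nonneg pos contr)
      then have "W = 0"
        by (rule zero_if_multiples_bounded)
      then show ?thesis
        using untransform[of Z] by (simp flip: W_def)
    qed
    show "Y \<in> {U ** (Xt + X0) ** matrix_inv V |X0. X0 \<in> imat_set X}"
      if X: "midm X = 0" and Y: "A0 ** Y ** B0 + C0 ** Y ** D0 = F0" for Y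
    proof -
      define W where "W = matrix_inv U ** Y ** V - Xt"
      define G where "G = F1 - A1 ** Xt ** B1 - C1 ** Xt ** D1"
      have "A1 ** (matrix_inv U ** Y ** V) ** B1 + C1 ** (matrix_inv U ** Y ** V) ** D1 = F1"
        by (simp add: transform Y F1_def)
      then have W: "A1 ** W ** B1 + C1 ** W ** D1 = G"
        by (simp add: W_def G_def matrix_diff_ldistrib matrix_diff_rdistrib algebra_simps)
      have G: "hdiv G S \<in> imat_set M"
        unfolding M G_def
      proof (rule hdiv_in_imat_hdiv[OF arith _ mem_point])
        show "F1 - A1 ** Xt ** B1 - C1 ** Xt ** D1 \<in> imat_set (imat_sub ar
            (imat_sub ar Fp (imat_mul ar (imat_mul ar Ap (point Xt)) Bp))
            (imat_mul ar (imat_mul ar Cp (point Xt)) Dp))"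
          by (intro diff_in_imat_sub mult_in_imat_mul arith mem_point mem1)
        show "0 \<notin> ival_set (point S $ i $ j)" for i j
          using S0[of i j] by (simp add: ival_set_point)
      qed
      have "mabs W \<le> radm X"
      proof (rule le_supersolution_if_subsolution[OF T_mono T_scale _ bound[OF W]])
        show "mabs (hdiv G S) $ i $ j + T (radm X) $ i $ j < radm X $ i $ j" for i j
          using strict[OF G, of i j] by (simp add: X mabs_def)
      qed (simp_all add: mabs_nonneg pos)
      then have "W \<in> imat_set X"
        by (simp add: mem_imat_set_iff X)
      moreover have "Y = U ** (Xt + W) ** matrix_inv V"
        by (simp add: W_def untransform)
      ultimately show ?thesis by blast
    qed
    show "\<exists>!Y. A0 ** Y ** B0 + C0 ** Y ** D0 = F0"
      by (rule sylvester_unique_solution[OF kernel])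
  qed
  have "\<exists>Y. A0 ** Y ** B0 + C0 ** Y ** D0 = F0 \<and>
      (\<forall>Z. A0 ** Z ** B0 + C0 ** Z ** D0 = F0 \<longrightarrow> Z = Y) \<and>
      (midm X = 0 \<longrightarrow> Y \<in> {U ** (Xt + X0) ** matrix_inv V |X0. X0 \<in> imat_set X})"
    if mem: "A0 \<in> imat_set A" "B0 \<in> imat_set B" "C0 \<in> imat_set C" "D0 \<in> imat_set D"
      "F0 \<in> imat_set F" for A0 B0 C0 D0 F0
  proof -
    obtain Y where Y: "A0 ** Y ** B0 + C0 ** Y ** D0 = F0"
      and unique: "\<And>Z. A0 ** Z ** B0 + C0 ** Z ** D0 = F0 \<Longrightarrow> Z = Y"
      using solution(1)[OF mem] by (elim ex1E) blast
    show ?thesis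
      by (intro exI[of _ Y] conjI allI impI Y unique solution(2)[OF mem])
  qed
  moreover have "united_solution_set A B C D F
      \<subseteq> {U ** (Xt + X0) ** matrix_inv V |X0. X0 \<in> imat_set X}" if "midm X = 0"
    unfolding united_solution_set_def
    by (intro subsetI, elim CollectE bexE) (rule solution(2)[OF _ _ _ _ _ that])
  ultimately show ?thesis
    using \<open>invertible R\<close> by (intro conjI ballI impI)
qed

end
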